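(* Let $f:A\to B$ and $g:A\to C$ be ring homomorphisms, and let $J$ be an ideal of $B$ and $J'$ an ideal of $C$ such that $I_o:=f^{-1}(J)=g^{-1}(J')$. Let $p$ be a prime ideal of $A$ containing $I_o$ and let $P:=p\bowtie^{f,g}(J,J')$. Consider the multiplicative subsets $S:=f(A\setminus p)+J$ of $B$ and $S':=g(A\setminus p)+J'$ of $C$. Let $f_p:A_p\to B_S$ and $g_p:A_p\to C_{S'}$ be the ring homomorphisms induced by $f$ and $g$. Then $$f_p^{-1}(J_S)=g_p^{-1}(J'_{S'})=(I_o)_p$$ and $$\big(A\bowtie^{f,g}(J,J')\big)_P\cong A_p\bowtie^{f_p,g_p}(J_S,J'_{S'}).$$
   Context: All rings are commutative with unity, and ring homomorphisms are unital. For ring homomorphisms $f:A\to B$, $g:A\to C$ and ideals $J$ of $B$, $J'$ of $C$ with $f^{-1}(J)=g^{-1}(J')$, the bi-amalgamation of $A$ with $(B,C)$ along $(J,J')$ with respect to $(f,g)$ is the subring of $B\times C$ $$A\bowtie^{f,g}(J,J'):=\{(f(a)+j,\,g(a)+j')\mid a\in A,\ (j,j')\in J\times J'\}.$$ For an ideal $I$ of $A$, $$I\bowtie^{f,g}(J,J'):=\{(f(i)+j,\,g(i)+j')\mid i\in I,\ (j,j')\in J\times J'\},$$ an ideal of $A\bowtie^{f,g}(J,J')$; it is prime when $I$ is a prime ideal containing $f^{-1}(J)$. Notation: $f(A\setminus p)+J=\{f(s)+j\mid s\in A\setminus p,\ j\in J\}$, and similarly for $g$; $B_S=S^{-1}B$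 and $C_{S'}=S'^{-1}C$ are the rings of fractions; $J_S=S^{-1}J$ and $J'_{S'}=S'^{-1}J'$ are the extended ideals; $A_p$ is the localization of $A$ at $p$, and $(I_o)_p=I_oA_p$; $R_P$ denotes the localization of a ring $R$ at a prime $P$. *)

theory Defs
  imports "HOL-Algebra.Chinese_Remainder"
begin

section \<open>Rings of fractions\<close>

text \<open>\<open>fraction R S a s\<close> is the fraction \<open>a/s\<close>, i.e. the class of all pairs \<open>(b, t)\<close> with
  \<open>u (t a - s b) = 0\<close> for some \<open>u \<in> S\<close>. \<open>S\<close> may contain zero divisors.\<close>

definition fraction :: "('a, 'm) ring_scheme \<Rightarrow> 'a set \<Rightarrow> 'a \<Rightarrow> 'a \<Rightarrow> ('a \<times> 'a) set"
  where "fraction R S a s =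
    {(b, t). b \<in> carrier R \<and> t \<in> S \<and>
      (\<exists>u\<in>S. u \<otimes>\<^bsub>R\<^esub> (t \<otimes>\<^bsub>R\<^esub> a) = u \<otimes>\<^bsub>R\<^esub> (s \<otimes>\<^bsub>R\<^esub> b))}"

text \<open>The operations are unions over representatives; by \<open>fraction_add\<close> and \<open>fraction_mult\<close>
  below they are independent of the representatives.\<close>

definition fraction_ring :: "('a, 'm) ring_scheme \<Rightarrow> 'a set \<Rightarrow> ('a \<times> 'a) set ring"
  where "fraction_ring R S =
    \<lparr>carrier = {fraction R S a s | a s. a \<in> carrier R \<and> s \<in> S},
     mult = (\<lambda>X Y. \<Union>(a, s)\<in>X. \<Union>(b, t)\<in>Y. fraction R S (a \<otimes>\<^bsub>R\<^esub> b) (s \<otimes>\<^bsub>R\<^esub> t)),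
     one = fraction R S \<one>\<^bsub>R\<^esub> \<one>\<^bsub>R\<^esub>,
     zero = fraction R S \<zero>\<^bsub>R\<^esub> \<one>\<^bsub>R\<^esub>,
     add = (\<lambda>X Y. \<Union>(a, s)\<in>X. \<Union>(b, t)\<in>Y.
       fraction R S ((t \<otimes>\<^bsub>R\<^esub> a) \<oplus>\<^bsub>R\<^esub> (s \<otimes>\<^bsub>R\<^esub> b)) (s \<otimes>\<^bsub>R\<^esub> t))\<rparr>"

definition localization :: "('a, 'm) ring_scheme \<Rightarrow> 'a set \<Rightarrow> ('a \<times> 'a) set ring"
  where "localization R P = fraction_ring R (carrier R - P)"

text \<open>The ideal \<open>S\<^sup>-\<^sup>1J\<close>; see \<open>extended_ideal_eq_genideal\<close> for its description as the
  extension of \<open>J\<close> along the canonical map.\<close>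

definition extended_ideal :: "('a, 'm) ring_scheme \<Rightarrow> 'a set \<Rightarrow> 'a set \<Rightarrow> ('a \<times> 'a) set set"
  where "extended_ideal R S J = {fraction R S j s | j s. j \<in> J \<and> s \<in> S}"

text \<open>\<open>induced_map B T h\<close> sends \<open>a/s\<close> to \<open>h a / h s \<in> T\<^sup>-\<^sup>1B\<close>; it is meant for homomorphisms \<open>h\<close>
  that map the denominators of the source into \<open>T\<close> (see \<open>induced_map_fraction\<close> and
  \<open>induced_map_hom\<close>).\<close>

definition induced_map ::
    "('b, 'n) ring_scheme \<Rightarrow> 'b set \<Rightarrow> ('a \<Rightarrow> 'b) \<Rightarrow> ('a \<times> 'a) set \<Rightarrow> ('b \<times> 'b) set"
  where "induced_map B T h X = (\<Union>(a, s)\<in>X. fraction B T (h a) (h s))"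


section \<open>Bi-amalgamations\<close>

definition biamalg_set ::
    "('b, 'n) ring_scheme \<Rightarrow> ('c, 'k) ring_scheme \<Rightarrow> ('a \<Rightarrow> 'b) \<Rightarrow> ('a \<Rightarrow> 'c) \<Rightarrow>
      'a set \<Rightarrow> 'b set \<Rightarrow> 'c set \<Rightarrow> ('b \<times> 'c) set"
  where "biamalg_set B C f g I J J' =
    {(f i \<oplus>\<^bsub>B\<^esub> j, g i \<oplus>\<^bsub>C\<^esub> j') | i j j'. i \<in> I \<and> j \<in> J \<and> j' \<in> J'}"

definition biamalg ::
    "('a, 'm) ring_scheme \<Rightarrow> ('b, 'n) ring_scheme \<Rightarrow> ('c, 'k) ring_scheme \<Rightarrow>
      ('a \<Rightarrow> 'b) \<Rightarrow> ('a \<Rightarrow> 'c) \<Rightarrow> 'b set \<Rightarrow> 'c set \<Rightarrow> ('b \<times> 'c) ring"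
  where "biamalg A B C f g J J' =
    (RDirProd B C)\<lparr>carrier := biamalg_set B C f g (carrier A) J J'\<rparr>"


section \<open>Well-definedness\<close>

text \<open>The definitions above make sense for arbitrary arguments; the lemmas below show that, under
  the intended hypotheses, they yield commutative rings, ring homomorphisms, ideals, multiplicative
  subsets and prime ideals.\<close>

locale mult_subset = cring R + S: submonoid S R for R (structure) and S
begin

lemma S_carr: "s \<in> S \<Longrightarrow> s \<in> carrier R"
  using S.subset by blast

abbreviation rel where
  "rel a s b t \<equiv> \<exists>u\<in>S. u \<otimes> (t \<otimes> a) = u \<otimes> (s \<otimes> b)"

lemma rel_trans:
  assumes "a \<in> carrier R" "b \<in> carrier R" "c \<in> carrier R" "s \<in> S" "t \<in> S" "r \<in> S"
    and "rel a s b t" "rel b t c r"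
  shows "rel a s c r"
proof -
  obtain u v where u: "u \<in> S" "u \<otimes> (t \<otimes> a) = u \<otimes> (s \<otimes> b)"
    and v: "v \<in> S" "v \<otimes> (r \<otimes> b) = v \<otimes> (t \<otimes> c)"
    using assms by auto
  note carr = assms(1-3) assms(4-6)[THEN S_carr] u(1)[THEN S_carr] v(1)[THEN S_carr]
  have "(u \<otimes> v \<otimes> t) \<otimes> (r \<otimes> a) = (v \<otimes> r) \<otimes> (u \<otimes> (t \<otimes> a))"
    using carr by algebra
  also have "\<dots> = (u \<otimes> s) \<otimes> (v \<otimes> (r \<otimes> b))"
    unfolding u(2) using carr by algebra
  also have "\<dots> = (u \<otimes> v \<otimes> t) \<otimes> (s \<otimes> c)"
    unfolding v(2) using carr by algebra
  finally show ?thesis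
    using u(1) v(1) assms(5) by (intro bexI[of _ "u \<otimes> v \<otimes> t"]) auto
qed

lemma rel_sym: "rel a s b t \<Longrightarrow> rel b t a s"
  by metis

lemma fraction_eq_iff:
  assumes "a \<in> carrier R" "b \<in> carrier R" "s \<in> S" "t \<in> S"
  shows "fraction R S a s = fraction R S b t \<longleftrightarrow> rel a s b t"
proof
  assume eq: "fraction R S a s = fraction R S b t"
  have "(b, t) \<in> fraction R S b t"
    using assms unfolding fraction_def by auto
  then show "rel a s b t"
    unfolding eq[symmetric] unfolding fraction_def by auto
next
  assume r: "rel a s b t"
  show "fraction R S a s = fraction R S b t"
    unfolding fraction_def
    using rel_trans[OF assms(1,2) _ assms(3,4) _ r]
      rel_trans[OF assms(2,1) _ assms(4,3) _ rel_sym[OF r]] by blast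
qed

lemma fraction_self: "a \<in> carrier R \<Longrightarrow> s \<in> S \<Longrightarrow> (a, s) \<in> fraction R S a s"
  unfolding fraction_def by auto

lemma fraction_memD:
  assumes "(b, t) \<in> fraction R S a s" "a \<in> carrier R" "s \<in> S"
  shows "b \<in> carrier R" "t \<in> S" "fraction R S b t = fraction R S a s"
proof -
  show bt: "b \<in> carrier R" "t \<in> S"
    using assms(1) unfolding fraction_def by auto
  have "rel a s b t"
    using assms(1) unfolding fraction_def by auto
  then show "fraction R S b t = fraction R S a s"
    using fraction_eq_iff assms(2,3) bt by metis
qed

lemma fraction_UN:
  assumes "a \<in> carrier R" "s \<in> S"
    and "\<And>b t. \<lbrakk>b \<in> carrier R; t \<in> S; fraction R S b t = fraction R S a s\<rbrakk> \<Longrightarrow> F b t = F a s"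
  shows "(\<Union>(b, t)\<in>fraction R S a s. F b t) = F a s"
proof -
  have "F b t = F a s" if "(b, t) \<in> fraction R S a s" for b t
    using assms(3) fraction_memD[OF that assms(1,2)] by blast
  with fraction_self[OF assms(1,2)] show ?thesis
    by fast
qed

lemma fraction_mult_cong:
  assumes "a \<in> carrier R" "a' \<in> carrier R" "b \<in> carrier R" "b' \<in> carrier R"
    "s \<in> S" "s' \<in> S" "t \<in> S" "t' \<in> S"
    and "fraction R S a s = fraction R S a' s'" "fraction R S b t = fraction R S b' t'"
  shows "fraction R S (a \<otimes> b) (s \<otimes> t) = fraction R S (a' \<otimes> b') (s' \<otimes> t')"
proof -
  obtain u v where u: "u \<in> S" "u \<otimes> (s' \<otimes> a) = u \<otimes> (s \<otimes> a')"
    and v: "v \<in> S" "v \<otimes> (t' \<otimes> b) = v \<otimes> (t \<otimes> b')"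
    using assms fraction_eq_iff by metis
  note carr = assms(1-4) assms(5-8)[THEN S_carr] u(1)[THEN S_carr] v(1)[THEN S_carr]
  have "(u \<otimes> v) \<otimes> ((s' \<otimes> t') \<otimes> (a \<otimes> b)) = (u \<otimes> (s' \<otimes> a)) \<otimes> (v \<otimes> (t' \<otimes> b))"
    using carr by algebra
  also have "\<dots> = (u \<otimes> v) \<otimes> ((s \<otimes> t) \<otimes> (a' \<otimes> b'))"
    unfolding u(2) v(2) using carr by algebra
  finally show ?thesis
    using assms u(1) v(1) by (subst fraction_eq_iff) auto
qed

lemma fraction_add_cong:
  assumes "a \<in> carrier R" "a' \<in> carrier R" "b \<in> carrier R" "b' \<in> carrier R"
    "s \<in> S" "s' \<in> S" "t \<in> S" "t' \<in> S"
    and "fraction R S a s = fraction R S a' s'" "fraction R S b t = fraction R S b' t'"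
  shows "fraction R S (t \<otimes> a \<oplus> s \<otimes> b) (s \<otimes> t) = fraction R S (t' \<otimes> a' \<oplus> s' \<otimes> b') (s' \<otimes> t')"
proof -
  obtain u v where u: "u \<in> S" "u \<otimes> (s' \<otimes> a) = u \<otimes> (s \<otimes> a')"
    and v: "v \<in> S" "v \<otimes> (t' \<otimes> b) = v \<otimes> (t \<otimes> b')"
    using assms fraction_eq_iff by metis
  note carr = assms(1-4) assms(5-8)[THEN S_carr] u(1)[THEN S_carr] v(1)[THEN S_carr]
  have "(u \<otimes> v) \<otimes> ((s' \<otimes> t') \<otimes> (t \<otimes> a \<oplus> s \<otimes> b)) =
      (v \<otimes> t \<otimes> t') \<otimes> (u \<otimes> (s' \<otimes> a)) \<oplus> (u \<otimes> s \<otimes> s') \<otimes> (v \<otimes> (t' \<otimes> b))"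
    using carr by algebra
  also have "\<dots> = (u \<otimes> v) \<otimes> ((s \<otimes> t) \<otimes> (t' \<otimes> a' \<oplus> s' \<otimes> b'))"
    unfolding u(2) v(2) using carr by algebra
  finally show ?thesis
    using assms u(1) v(1) carr by (subst fraction_eq_iff) auto
qed

lemma fraction_mult:
  assumes "a \<in> carrier R" "s \<in> S" "b \<in> carrier R" "t \<in> S"
  shows "fraction R S a s \<otimes>\<^bsub>fraction_ring R S\<^esub> fraction R S b t = fraction R S (a \<otimes> b) (s \<otimes> t)"
proof -
  have inner: "(\<Union>(b', t')\<in>fraction R S b t. fraction R S (a' \<otimes> b') (s' \<otimes> t')) =
      fraction R S (a' \<otimes> b) (s' \<otimes> t)" if "a' \<in> carrier R" "s' \<in> S" for a' s'
    using assms that by (intro fraction_UN fraction_mult_cong) auto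
  have "(\<Union>(a', s')\<in>fraction R S a s. \<Union>(b', t')\<in>fraction R S b t.
      fraction R S (a' \<otimes> b') (s' \<otimes> t')) =
      (\<Union>(b', t')\<in>fraction R S b t. fraction R S (a \<otimes> b') (s \<otimes> t'))"
    using assms(1,2)
  proof (rule fraction_UN)
    fix a' s'
    assume "a' \<in> carrier R" "s' \<in> S" "fraction R S a' s' = fraction R S a s"
    with assms show "(\<Union>(b', t')\<in>fraction R S b t. fraction R S (a' \<otimes> b') (s' \<otimes> t')) =
        (\<Union>(b', t')\<in>fraction R S b t. fraction R S (a \<otimes> b') (s \<otimes> t'))"
      by (simp only: inner) (rule fraction_mult_cong; simp)
  qed
  then show ?thesis
    using inner assms by (simp add: fraction_ring_def)
qed

lemma fraction_add:
  assumes "a \<in> carrier R" "s \<in> S" "b \<in> carrier R" "t \<in> S"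
  shows "fraction R S a s \<oplus>\<^bsub>fraction_ring R S\<^esub> fraction R S b t =
    fraction R S (t \<otimes> a \<oplus> s \<otimes> b) (s \<otimes> t)"
proof -
  have inner: "(\<Union>(b', t')\<in>fraction R S b t. fraction R S (t' \<otimes> a' \<oplus> s' \<otimes> b') (s' \<otimes> t')) =
      fraction R S (t \<otimes> a' \<oplus> s' \<otimes> b) (s' \<otimes> t)" if "a' \<in> carrier R" "s' \<in> S" for a' s'
    using assms that
    by (intro fraction_UN[where F = "\<lambda>b' t'. fraction R S (t' \<otimes> a' \<oplus> s' \<otimes> b') (s' \<otimes> t')"]
        fraction_add_cong) auto
  have "(\<Union>(a', s')\<in>fraction R S a s. \<Union>(b', t')\<in>fraction R S b t.
      fraction R S (t' \<otimes> a' \<oplus> s' \<otimes> b') (s' \<otimes> t')) =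
      (\<Union>(b', t')\<in>fraction R S b t. fraction R S (t' \<otimes> a \<oplus> s \<otimes> b') (s \<otimes> t'))"
    using assms(1,2)
  proof (rule fraction_UN)
    fix a' s'
    assume "a' \<in> carrier R" "s' \<in> S" "fraction R S a' s' = fraction R S a s"
    with assms show "(\<Union>(b', t')\<in>fraction R S b t. fraction R S (t' \<otimes> a' \<oplus> s' \<otimes> b') (s' \<otimes> t')) =
        (\<Union>(b', t')\<in>fraction R S b t. fraction R S (t' \<otimes> a \<oplus> s \<otimes> b') (s \<otimes> t'))"
      by (simp only: inner) (rule fraction_add_cong; simp)
  qed
  then show ?thesis
    using inner assms by (simp add: fraction_ring_def)
qed

lemma fraction_closed:
  "a \<in> carrier R \<Longrightarrow> s \<in> S \<Longrightarrow> fraction R S a s \<in> carrier (fraction_ring R S)"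
  unfolding fraction_ring_def by auto

lemma fraction_cases:
  assumes "x \<in> carrier (fraction_ring R S)"
  obtains a s where "x = fraction R S a s" "a \<in> carrier R" "s \<in> S"
  using assms unfolding fraction_ring_def by auto

lemma fraction_one: "\<one>\<^bsub>fraction_ring R S\<^esub> = fraction R S \<one> \<one>"
  and fraction_zero: "\<zero>\<^bsub>fraction_ring R S\<^esub> = fraction R S \<zero> \<one>"
  unfolding fraction_ring_def by auto

lemma fraction_eqI:
  assumes "a \<in> carrier R" "b \<in> carrier R" "s \<in> S" "t \<in> S" "t \<otimes> a = s \<otimes> b"
  shows "fraction R S a s = fraction R S b t"
  using assms fraction_eq_iff[OF assms(1-4)] S.one_closed by metis

lemma fraction_ring_cring: "cring (fraction_ring R S)"
proof (rule cringI)
  let ?Q = "fraction_ring R S"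
  note simps = fraction_mult fraction_add fraction_one fraction_zero S_carr
  show "abelian_group ?Q"
  proof (rule abelian_groupI)
    fix x y assume "x \<in> carrier ?Q" "y \<in> carrier ?Q"
    then show "x \<oplus>\<^bsub>?Q\<^esub> y \<in> carrier ?Q"
      by (elim fraction_cases) (auto simp: simps intro!: fraction_closed)
  next
    show "\<zero>\<^bsub>?Q\<^esub> \<in> carrier ?Q"
      by (auto simp: simps intro!: fraction_closed)
  next
    fix x y z assume "x \<in> carrier ?Q" "y \<in> carrier ?Q" "z \<in> carrier ?Q"
    then obtain a s b t c r where
      xyz: "x = fraction R S a s" "y = fraction R S b t" "z = fraction R S c r"
      and m: "a \<in> carrier R" "b \<in> carrier R" "c \<in> carrier R" "s \<in> S" "t \<in> S" "r \<in> S"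
      by (elim fraction_cases) blast
    note carr = m(1-3) m(4-6)[THEN S_carr]
    have "r \<otimes> (t \<otimes> a \<oplus> s \<otimes> b) \<oplus> (s \<otimes> t) \<otimes> c = (t \<otimes> r) \<otimes> a \<oplus> s \<otimes> (r \<otimes> b \<oplus> t \<otimes> c)"
      "s \<otimes> t \<otimes> r = s \<otimes> (t \<otimes> r)"
      using carr by algebra+
    then show "x \<oplus>\<^bsub>?Q\<^esub> y \<oplus>\<^bsub>?Q\<^esub> z = x \<oplus>\<^bsub>?Q\<^esub> (y \<oplus>\<^bsub>?Q\<^esub> z)"
      using m carr by (simp add: xyz simps)
  next
    fix x y assume "x \<in> carrier ?Q" "y \<in> carrier ?Q"
    then show "x \<oplus>\<^bsub>?Q\<^esub> y = y \<oplus>\<^bsub>?Q\<^esub> x"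
      by (elim fraction_cases) (auto simp: simps a_comm m_comm)
  next
    fix x assume "x \<in> carrier ?Q"
    then show "\<zero>\<^bsub>?Q\<^esub> \<oplus>\<^bsub>?Q\<^esub> x = x"
      by (elim fraction_cases) (auto simp: simps)
  next
    fix x assume "x \<in> carrier ?Q"
    then obtain a s where x: "x = fraction R S a s" and m: "a \<in> carrier R" "s \<in> S"
      by (elim fraction_cases) blast
    have e: "s \<otimes> (\<ominus> a) \<oplus> s \<otimes> a = \<zero>" "\<one> \<otimes> \<zero> = (s \<otimes> s) \<otimes> \<zero>"
      using m S_carr by algebra+
    have "fraction R S (\<ominus> a) s \<oplus>\<^bsub>?Q\<^esub> x = fraction R S \<zero> \<one>"
      using m S_carr e(1) by (simp add: x simps) (rule fraction_eqI, auto)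
    then show "\<exists>y\<in>carrier ?Q. y \<oplus>\<^bsub>?Q\<^esub> x = \<zero>\<^bsub>?Q\<^esub>"
      using m by (intro bexI[of _ "fraction R S (\<ominus> a) s"]) (auto simp: simps fraction_closed)
  qed
  show "comm_monoid ?Q"
  proof (rule comm_monoidI)
    fix x y assume "x \<in> carrier ?Q" "y \<in> carrier ?Q"
    then show "x \<otimes>\<^bsub>?Q\<^esub> y \<in> carrier ?Q"
      by (elim fraction_cases) (auto simp: simps intro!: fraction_closed)
  next
    show "\<one>\<^bsub>?Q\<^esub> \<in> carrier ?Q"
      by (auto simp: simps intro!: fraction_closed)
  next
    fix x y z assume "x \<in> carrier ?Q" "y \<in> carrier ?Q" "z \<in> carrier ?Q"
    then show "x \<otimes>\<^bsub>?Q\<^esub> y \<otimes>\<^bsub>?Q\<^esub> z = x \<otimes>\<^bsub>?Q\<^esub> (y \<otimes>\<^bsub>?Q\<^esub> z)"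
      by (elim fraction_cases) (auto simp: simps m_assoc)
  next
    fix x assume "x \<in> carrier ?Q"
    then show "\<one>\<^bsub>?Q\<^esub> \<otimes>\<^bsub>?Q\<^esub> x = x"
      by (elim fraction_cases) (auto simp: simps)
  next
    fix x y assume "x \<in> carrier ?Q" "y \<in> carrier ?Q"
    then show "x \<otimes>\<^bsub>?Q\<^esub> y = y \<otimes>\<^bsub>?Q\<^esub> x"
      by (elim fraction_cases) (auto simp: simps m_comm)
  qed
  fix x y z assume "x \<in> carrier ?Q" "y \<in> carrier ?Q" "z \<in> carrier ?Q"
  then obtain a s b t c r where
    xyz: "x = fraction R S a s" "y = fraction R S b t" "z = fraction R S c r"
    and m: "a \<in> carrier R" "b \<in> carrier R" "c \<in> carrier R" "s \<in> S" "t \<in> S" "r \<in> S"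
    by (elim fraction_cases) blast
  note carr = m(1-3) m(4-6)[THEN S_carr]
  have "(s \<otimes> r \<otimes> (t \<otimes> r)) \<otimes> ((t \<otimes> a \<oplus> s \<otimes> b) \<otimes> c) =
      (s \<otimes> t \<otimes> r) \<otimes> (t \<otimes> r \<otimes> (a \<otimes> c) \<oplus> s \<otimes> r \<otimes> (b \<otimes> c))"
    using carr by algebra
  then show "(x \<oplus>\<^bsub>?Q\<^esub> y) \<otimes>\<^bsub>?Q\<^esub> z = x \<otimes>\<^bsub>?Q\<^esub> z \<oplus>\<^bsub>?Q\<^esub> y \<otimes>\<^bsub>?Q\<^esub> z"
    using m carr by (simp add: xyz simps) (rule fraction_eqI, auto)
qed

lemma extended_ideal_eq_genideal:
  assumes "ideal J R"
  shows "extended_ideal R S J = genideal (fraction_ring R S) ((\<lambda>j. fraction R S j \<one>) ` J)"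
proof -
  let ?Q = "fraction_ring R S"
  interpret J: ideal J R by fact
  interpret Q: cring ?Q by (rule fraction_ring_cring)
  note simps = fraction_mult fraction_add fraction_one fraction_zero S_carr
  have Jc: "j \<in> carrier R" if "j \<in> J" for j
    using that by (rule J.a_Hcarr)
  have sub: "extended_ideal R S J \<subseteq> carrier ?Q"
    unfolding extended_ideal_def using Jc fraction_closed by auto
  have "ideal (extended_ideal R S J) ?Q"
  proof (rule idealI[OF Q.ring_axioms])
    show "subgroup (extended_ideal R S J) (add_monoid ?Q)"
    proof (rule group.subgroupI)
      show "group (add_monoid ?Q)"
        by (rule Q.a_group)
      show "extended_ideal R S J \<subseteq> carrier (add_monoid ?Q)"
        using sub by simp
      show "extended_ideal R S J \<noteq> {}"
        unfolding extended_ideal_def using J.zero_closed S.one_closed by blast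
    next
      fix x assume "x \<in> extended_ideal R S J"
      then obtain j s where x: "x = fraction R S j s" and m: "j \<in> J" "s \<in> S"
        unfolding extended_ideal_def by auto
      have "fraction R S (\<ominus> j) s \<oplus>\<^bsub>?Q\<^esub> x = \<zero>\<^bsub>?Q\<^esub>"
      proof -
        have "s \<otimes> (\<ominus> j) \<oplus> s \<otimes> j = \<zero>"
          using m S_carr Jc by algebra
        then show ?thesis
          using m S_carr Jc by (simp add: x simps) (rule fraction_eqI, auto)
      qed
      then have "\<ominus>\<^bsub>?Q\<^esub> x = fraction R S (\<ominus> j) s"
        using m Jc by (intro Q.minus_equality) (auto simp: x fraction_closed)
      moreover have "\<ominus> j \<in> J"
        using m(1) by (rule J.a_inv_closed)
      ultimately show "inv\<^bsub>add_monoid ?Q\<^esub> x \<in> extended_ideal R S J"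
        using m unfolding extended_ideal_def a_inv_def by auto
    next
      fix x y assume "x \<in> extended_ideal R S J" "y \<in> extended_ideal R S J"
      then obtain j s k t where xy: "x = fraction R S j s" "y = fraction R S k t"
        and m: "j \<in> J" "s \<in> S" "k \<in> J" "t \<in> S"
        unfolding extended_ideal_def by auto
      have "t \<otimes> j \<oplus> s \<otimes> k \<in> J"
        using m S_carr by (intro J.a_closed J.I_l_closed) auto
      then show "x \<otimes>\<^bsub>add_monoid ?Q\<^esub> y \<in> extended_ideal R S J"
        using m Jc unfolding extended_ideal_def by (auto simp: xy simps)
    qed
  next
    fix x y assume "x \<in> extended_ideal R S J" "y \<in> carrier ?Q"
    then obtain j s b t where xy: "x = fraction R S j s" "y = fraction R S b t"
      and m: "j \<in> J" "s \<in> S" "b \<in> carrier R" "t \<in> S"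
      unfolding extended_ideal_def by (auto elim!: fraction_cases)
    have "b \<otimes> j \<in> J" "j \<otimes> b \<in> J"
      using m by (auto intro: J.I_l_closed J.I_r_closed)
    then show "y \<otimes>\<^bsub>?Q\<^esub> x \<in> extended_ideal R S J" "x \<otimes>\<^bsub>?Q\<^esub> y \<in> extended_ideal R S J"
      using m Jc unfolding extended_ideal_def by (auto simp: xy simps)
  qed
  moreover have "(\<lambda>j. fraction R S j \<one>) ` J \<subseteq> extended_ideal R S J"
    unfolding extended_ideal_def using S.one_closed by blast
  ultimately have 1: "genideal ?Q ((\<lambda>j. fraction R S j \<one>) ` J) \<subseteq> extended_ideal R S J"
    by (rule Q.genideal_minimal)
  have img: "(\<lambda>j. fraction R S j \<one>) ` J \<subseteq> carrier ?Q"
    using Jc fraction_closed by auto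
  interpret I: ideal "genideal ?Q ((\<lambda>j. fraction R S j \<one>) ` J)" ?Q
    by (rule Q.genideal_ideal[OF img])
  have "fraction R S j s \<in> genideal ?Q ((\<lambda>j. fraction R S j \<one>) ` J)" if "j \<in> J" "s \<in> S" for j s
  proof -
    have "fraction R S \<one> s \<otimes>\<^bsub>?Q\<^esub> fraction R S j \<one> \<in> genideal ?Q ((\<lambda>j. fraction R S j \<one>) ` J)"
      using that Q.genideal_self[OF img] by (intro I.I_l_closed) (auto intro: fraction_closed)
    then show ?thesis
      using that Jc S_carr by (simp add: simps)
  qed
  then have 2: "extended_ideal R S J \<subseteq> genideal ?Q ((\<lambda>j. fraction R S j \<one>) ` J)"
    unfolding extended_ideal_def by auto
  from 1 2 show ?thesis by blast
qed

end

lemma induced_map_fraction: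
  assumes "mult_subset A U" "mult_subset B T" "h \<in> ring_hom A B" "h ` U \<subseteq> T"
    and "a \<in> carrier A" "s \<in> U"
  shows "induced_map B T h (fraction A U a s) = fraction B T (h a) (h s)"
proof -
  interpret A: mult_subset A U by fact
  interpret B: mult_subset B T by fact
  have hc: "h x \<in> carrier B" if "x \<in> carrier A" for x
    using ring_hom_closed[OF assms(3) that] .
  show ?thesis
    unfolding induced_map_def
  proof (rule A.fraction_UN)
    fix b t assume m: "b \<in> carrier A" "t \<in> U" and eq: "fraction A U b t = fraction A U a s"
    obtain u where u: "u \<in> U" "u \<otimes>\<^bsub>A\<^esub> (s \<otimes>\<^bsub>A\<^esub> b) = u \<otimes>\<^bsub>A\<^esub> (t \<otimes>\<^bsub>A\<^esub> a)"
      using A.fraction_eq_iff eq m assms(5,6) by metis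
    have "h (u \<otimes>\<^bsub>A\<^esub> (s \<otimes>\<^bsub>A\<^esub> b)) = h (u \<otimes>\<^bsub>A\<^esub> (t \<otimes>\<^bsub>A\<^esub> a))"
      using u by simp
    then have "h u \<otimes>\<^bsub>B\<^esub> (h s \<otimes>\<^bsub>B\<^esub> h b) = h u \<otimes>\<^bsub>B\<^esub> (h t \<otimes>\<^bsub>B\<^esub> h a)"
      using u(1) m assms(5,6) A.S_carr by (simp add: ring_hom_mult[OF assms(3)])
    moreover have "h u \<in> T" "h s \<in> T" "h t \<in> T"
      using u(1) m assms(4,6) by auto
    ultimately show "fraction B T (h b) (h t) = fraction B T (h a) (h s)"
      using m assms(5) hc B.fraction_eq_iff by metis
  qed fact+
qed

lemma induced_map_hom:
  assumes "mult_subset A U" "mult_subset B T" "h \<in> ring_hom A B" "h ` U \<subseteq> T"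
  shows "induced_map B T h \<in> ring_hom (fraction_ring A U) (fraction_ring B T)"
proof -
  interpret A: mult_subset A U by fact
  interpret B: mult_subset B T by fact
  note ind = induced_map_fraction[OF assms]
  have hc: "h x \<in> carrier B" if "x \<in> carrier A" for x
    using ring_hom_closed[OF assms(3) that] .
  have hT: "h s \<in> T" if "s \<in> U" for s
    using that assms(4) by auto
  note hom = ring_hom_mult[OF assms(3)] ring_hom_add[OF assms(3)] ring_hom_one[OF assms(3)]
  show ?thesis
  proof (rule ring_hom_memI)
    fix x assume "x \<in> carrier (fraction_ring A U)"
    then show "induced_map B T h x \<in> carrier (fraction_ring B T)"
      by (elim A.fraction_cases) (auto simp: ind hc hT intro!: B.fraction_closed)
  next
    fix x y assume "x \<in> carrier (fraction_ring A U)" "y \<in> carrier (fraction_ring A U)"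
    then show
      "induced_map B T h (x \<otimes>\<^bsub>fraction_ring A U\<^esub> y) =
        induced_map B T h x \<otimes>\<^bsub>fraction_ring B T\<^esub> induced_map B T h y"
      "induced_map B T h (x \<oplus>\<^bsub>fraction_ring A U\<^esub> y) =
        induced_map B T h x \<oplus>\<^bsub>fraction_ring B T\<^esub> induced_map B T h y"
      by (elim A.fraction_cases;
          simp add: A.fraction_mult B.fraction_mult A.fraction_add B.fraction_add
            ind hc hT hom A.S_carr)+
  next
    show "induced_map B T h \<one>\<^bsub>fraction_ring A U\<^esub> = \<one>\<^bsub>fraction_ring B T\<^esub>"
      by (simp add: A.fraction_one B.fraction_one ind hom)
  qed
qed

lemma mult_subset_complement:
  assumes "primeideal p A"
  shows "mult_subset A (carrier A - p)"
proof -
  interpret primeideal p A by fact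
  have "\<one>\<^bsub>A\<^esub> \<notin> p"
    using one_imp_carrier I_notcarr by blast
  then show ?thesis
    by unfold_locales (auto dest: I_prime)
qed

lemma mult_subset_image:
  assumes "cring A" "cring B" "h \<in> ring_hom A B" "ideal J B" "primeideal p A"
  shows "mult_subset B (h ` (carrier A - p) <+>\<^bsub>B\<^esub> J)"
    and "h ` (carrier A - p) \<subseteq> h ` (carrier A - p) <+>\<^bsub>B\<^esub> J"
proof -
  interpret A: cring A by fact
  interpret B: cring B by fact
  interpret J: ideal J B by fact
  interpret U: mult_subset A "carrier A - p"
    by (rule mult_subset_complement) fact
  let ?S = "h ` (carrier A - p) <+>\<^bsub>B\<^esub> J"
  have hc: "h x \<in> carrier B" if "x \<in> carrier A" for x
    using ring_hom_closed[OF assms(3) that] .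
  have S_iff: "x \<in> ?S \<longleftrightarrow> (\<exists>s j. x = h s \<oplus>\<^bsub>B\<^esub> j \<and> s \<in> carrier A - p \<and> j \<in> J)" for x
    unfolding set_add_def set_mult_def by auto
  show sub: "h ` (carrier A - p) \<subseteq> ?S"
  proof
    fix x assume "x \<in> h ` (carrier A - p)"
    then obtain s where "s \<in> carrier A - p" "x = h s \<oplus>\<^bsub>B\<^esub> \<zero>\<^bsub>B\<^esub>"
      using hc by auto
    then show "x \<in> ?S"
      unfolding S_iff using J.zero_closed by blast
  qed
  have "x \<otimes>\<^bsub>B\<^esub> y \<in> ?S" if "x \<in> ?S" "y \<in> ?S" for x y
  proof -
    from that obtain s j t k where xy: "x = h s \<oplus>\<^bsub>B\<^esub> j" "y = h t \<oplus>\<^bsub>B\<^esub> k"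
      and m: "s \<in> carrier A - p" "t \<in> carrier A - p" "j \<in> J" "k \<in> J"
      unfolding S_iff by auto
    have hB: "h s \<in> carrier B" "h t \<in> carrier B" "j \<in> carrier B" "k \<in> carrier B"
      using m hc J.a_Hcarr by auto
    then have "x \<otimes>\<^bsub>B\<^esub> y =
        (h s \<otimes>\<^bsub>B\<^esub> h t) \<oplus>\<^bsub>B\<^esub> (h s \<otimes>\<^bsub>B\<^esub> k \<oplus>\<^bsub>B\<^esub> j \<otimes>\<^bsub>B\<^esub> (h t \<oplus>\<^bsub>B\<^esub> k))"
      unfolding xy by algebra
    also have "h s \<otimes>\<^bsub>B\<^esub> h t = h (s \<otimes>\<^bsub>A\<^esub> t)"
      using m by (simp add: ring_hom_mult[OF assms(3)])
    finally have "x \<otimes>\<^bsub>B\<^esub> y =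
        h (s \<otimes>\<^bsub>A\<^esub> t) \<oplus>\<^bsub>B\<^esub> (h s \<otimes>\<^bsub>B\<^esub> k \<oplus>\<^bsub>B\<^esub> j \<otimes>\<^bsub>B\<^esub> (h t \<oplus>\<^bsub>B\<^esub> k))" .
    moreover have "s \<otimes>\<^bsub>A\<^esub> t \<in> carrier A - p"
      using m by (intro U.S.m_closed)
    moreover have "h s \<otimes>\<^bsub>B\<^esub> k \<oplus>\<^bsub>B\<^esub> j \<otimes>\<^bsub>B\<^esub> (h t \<oplus>\<^bsub>B\<^esub> k) \<in> J"
      using m hB by (intro J.a_closed J.I_l_closed J.I_r_closed) auto
    ultimately show ?thesis
      unfolding S_iff by blast
  qed
  moreover have "h \<one>\<^bsub>A\<^esub> \<in> ?S"
    using sub U.S.one_closed by blast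
  then have "\<one>\<^bsub>B\<^esub> \<in> ?S"
    using ring_hom_one[OF assms(3)] by simp
  moreover have "?S \<subseteq> carrier B"
    using hc J.a_Hcarr by (auto simp: S_iff)
  ultimately show "mult_subset B ?S"
    by (simp add: mult_subset_def B.is_cring submonoid_def)
qed

lemma biamalg_simps:
  "carrier (biamalg A B C f g J J') = biamalg_set B C f g (carrier A) J J'"
  "(b, c) \<otimes>\<^bsub>biamalg A B C f g J J'\<^esub> (b', c') = (b \<otimes>\<^bsub>B\<^esub> b', c \<otimes>\<^bsub>C\<^esub> c')"
  "(b, c) \<oplus>\<^bsub>biamalg A B C f g J J'\<^esub> (b', c') = (b \<oplus>\<^bsub>B\<^esub> b', c \<oplus>\<^bsub>C\<^esub> c')"
  "\<one>\<^bsub>biamalg A B C f g J J'\<^esub> = (\<one>\<^bsub>B\<^esub>, \<one>\<^bsub>C\<^esub>)"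
  "\<zero>\<^bsub>biamalg A B C f g J J'\<^esub> = (\<zero>\<^bsub>B\<^esub>, \<zero>\<^bsub>C\<^esub>)"
  unfolding biamalg_def RDirProd_def DirProd_def by (simp_all add: monoid.defs)

lemma hom_plus_ideal:
  assumes "cring A" "cring B" "h \<in> ring_hom A B" "ideal J B"
    and "a \<in> carrier A" "b \<in> carrier A" "j \<in> J" "k \<in> J"
  shows "\<exists>l\<in>J. h a \<oplus>\<^bsub>B\<^esub> j \<oplus>\<^bsub>B\<^esub> (h b \<oplus>\<^bsub>B\<^esub> k) = h (a \<oplus>\<^bsub>A\<^esub> b) \<oplus>\<^bsub>B\<^esub> l"
    and "\<exists>l\<in>J. (h a \<oplus>\<^bsub>B\<^esub> j) \<otimes>\<^bsub>B\<^esub> (h b \<oplus>\<^bsub>B\<^esub> k) = h (a \<otimes>\<^bsub>A\<^esub> b) \<oplus>\<^bsub>B\<^esub> l"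
    and "\<exists>l\<in>J. h (\<ominus>\<^bsub>A\<^esub> a) \<oplus>\<^bsub>B\<^esub> l \<oplus>\<^bsub>B\<^esub> (h a \<oplus>\<^bsub>B\<^esub> j) = \<zero>\<^bsub>B\<^esub>"
    and "h a \<oplus>\<^bsub>B\<^esub> j = h b \<oplus>\<^bsub>B\<^esub> k \<Longrightarrow> h (a \<ominus>\<^bsub>A\<^esub> b) \<in> J"
    and "h a \<oplus>\<^bsub>B\<^esub> j \<in> carrier B"
proof -
  interpret A: cring A by fact
  interpret B: cring B by fact
  interpret J: ideal J B by fact
  interpret h: ring_hom_cring A B h
    using assms by (intro ring_hom_cring.intro ring_hom_cring_axioms.intro) auto
  have m: "h a \<in> carrier B" "h b \<in> carrier B" "j \<in> carrier B" "k \<in> carrier B"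
    using assms J.a_Hcarr by auto
  have "h a \<oplus>\<^bsub>B\<^esub> j \<oplus>\<^bsub>B\<^esub> (h b \<oplus>\<^bsub>B\<^esub> k) = h (a \<oplus>\<^bsub>A\<^esub> b) \<oplus>\<^bsub>B\<^esub> (j \<oplus>\<^bsub>B\<^esub> k)"
    unfolding h.hom_add[OF assms(5,6)] using m by algebra
  moreover have "j \<oplus>\<^bsub>B\<^esub> k \<in> J"
    using assms(7,8) by (rule J.a_closed)
  ultimately show "\<exists>l\<in>J. h a \<oplus>\<^bsub>B\<^esub> j \<oplus>\<^bsub>B\<^esub> (h b \<oplus>\<^bsub>B\<^esub> k) = h (a \<oplus>\<^bsub>A\<^esub> b) \<oplus>\<^bsub>B\<^esub> l"
    by blast
  have "(h a \<oplus>\<^bsub>B\<^esub> j) \<otimes>\<^bsub>B\<^esub> (h b \<oplus>\<^bsub>B\<^esub> k) =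
      h (a \<otimes>\<^bsub>A\<^esub> b) \<oplus>\<^bsub>B\<^esub> (h a \<otimes>\<^bsub>B\<^esub> k \<oplus>\<^bsub>B\<^esub> j \<otimes>\<^bsub>B\<^esub> (h b \<oplus>\<^bsub>B\<^esub> k))"
    unfolding h.hom_mult[OF assms(5,6)] using m by algebra
  moreover have "h a \<otimes>\<^bsub>B\<^esub> k \<oplus>\<^bsub>B\<^esub> j \<otimes>\<^bsub>B\<^esub> (h b \<oplus>\<^bsub>B\<^esub> k) \<in> J"
    using m assms(7,8) by (intro J.a_closed J.I_l_closed J.I_r_closed) auto
  ultimately show "\<exists>l\<in>J. (h a \<oplus>\<^bsub>B\<^esub> j) \<otimes>\<^bsub>B\<^esub> (h b \<oplus>\<^bsub>B\<^esub> k) = h (a \<otimes>\<^bsub>A\<^esub> b) \<oplus>\<^bsub>B\<^esub> l"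
    by blast
  have "h (\<ominus>\<^bsub>A\<^esub> a) \<oplus>\<^bsub>B\<^esub> (\<ominus>\<^bsub>B\<^esub> j) \<oplus>\<^bsub>B\<^esub> (h a \<oplus>\<^bsub>B\<^esub> j) = \<zero>\<^bsub>B\<^esub>"
    unfolding h.hom_a_inv[OF assms(5)] using m by algebra
  moreover have "\<ominus>\<^bsub>B\<^esub> j \<in> J"
    using assms(7) by (rule J.a_inv_closed)
  ultimately show "\<exists>l\<in>J. h (\<ominus>\<^bsub>A\<^esub> a) \<oplus>\<^bsub>B\<^esub> l \<oplus>\<^bsub>B\<^esub> (h a \<oplus>\<^bsub>B\<^esub> j) = \<zero>\<^bsub>B\<^esub>"
    by blast
  show "h (a \<ominus>\<^bsub>A\<^esub> b) \<in> J" if eq: "h a \<oplus>\<^bsub>B\<^esub> j = h b \<oplus>\<^bsub>B\<^esub> k"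
  proof -
    have "h (a \<ominus>\<^bsub>A\<^esub> b) = h a \<oplus>\<^bsub>B\<^esub> (\<ominus>\<^bsub>B\<^esub> h b)"
      using assms(5,6) by (simp add: A.minus_eq)
    also have "\<dots> = (h a \<oplus>\<^bsub>B\<^esub> j) \<oplus>\<^bsub>B\<^esub> (\<ominus>\<^bsub>B\<^esub> h b \<oplus>\<^bsub>B\<^esub> (\<ominus>\<^bsub>B\<^esub> j))"
      using m by algebra
    also have "\<dots> = k \<oplus>\<^bsub>B\<^esub> (\<ominus>\<^bsub>B\<^esub> j)"
      unfolding eq using m by algebra
    finally show ?thesis
      using assms(7,8) by (simp add: J.a_inv_closed)
  qed
  show "h a \<oplus>\<^bsub>B\<^esub> j \<in> carrier B"
    using m by simp
qed

lemma biamalg_set_cases: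
  assumes "x \<in> biamalg_set B C f g I J J'"
  obtains i j j' where "x = (f i \<oplus>\<^bsub>B\<^esub> j, g i \<oplus>\<^bsub>C\<^esub> j')" "i \<in> I" "j \<in> J" "j' \<in> J'"
  using assms unfolding biamalg_set_def by auto

lemma biamalg_setI:
  "i \<in> I \<Longrightarrow> \<exists>l\<in>J. b = f i \<oplus>\<^bsub>B\<^esub> l \<Longrightarrow> \<exists>l\<in>J'. c = g i \<oplus>\<^bsub>C\<^esub> l \<Longrightarrow>
    (b, c) \<in> biamalg_set B C f g I J J'"
  unfolding biamalg_set_def by auto

lemma biamalg_cring:
  assumes "cring A" "cring B" "cring C" "f \<in> ring_hom A B" "g \<in> ring_hom A C"
    and "ideal J B" "ideal J' C"
  shows "cring (biamalg A B C f g J J')"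
proof -
  let ?D = "biamalg A B C f g J J'"
  interpret A: cring A by fact
  interpret B: cring B by fact
  interpret C: cring C by fact
  interpret J: ideal J B by fact
  interpret J': ideal J' C by fact
  interpret f: ring_hom_cring A B f
    using assms by (intro ring_hom_cring.intro ring_hom_cring_axioms.intro) auto
  interpret g: ring_hom_cring A C g
    using assms by (intro ring_hom_cring.intro ring_hom_cring_axioms.intro) auto
  note hB = hom_plus_ideal[OF assms(1,2,4,6)] and hC = hom_plus_ideal[OF assms(1,3,5,7)]
  have pair: "\<exists>b c. x = (b, c) \<and> b \<in> carrier B \<and> c \<in> carrier C" if "x \<in> carrier ?D" for x
  proof -
    from that obtain i j j' where "x = (f i \<oplus>\<^bsub>B\<^esub> j, g i \<oplus>\<^bsub>C\<^esub> j')" "i \<in> carrier A" "j \<in> J" "j' \<in> J'"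
      unfolding biamalg_simps by (elim biamalg_set_cases) blast
    then show ?thesis
      using hB(5)[of i i j j] hC(5)[of i i j' j'] by simp
  qed
  have add: "x \<oplus>\<^bsub>?D\<^esub> y \<in> carrier ?D" and mult: "x \<otimes>\<^bsub>?D\<^esub> y \<in> carrier ?D"
    if "x \<in> carrier ?D" "y \<in> carrier ?D" for x y
  proof -
    from that obtain i j j' k l l' where xy: "x = (f i \<oplus>\<^bsub>B\<^esub> j, g i \<oplus>\<^bsub>C\<^esub> j')"
        "y = (f k \<oplus>\<^bsub>B\<^esub> l, g k \<oplus>\<^bsub>C\<^esub> l')"
      and m: "i \<in> carrier A" "j \<in> J" "j' \<in> J'" "k \<in> carrier A" "l \<in> J" "l' \<in> J'"
      unfolding biamalg_simps by (elim biamalg_set_cases) blast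
    show "x \<oplus>\<^bsub>?D\<^esub> y \<in> carrier ?D"
      unfolding xy biamalg_simps using m
      by (intro biamalg_setI[where i = "i \<oplus>\<^bsub>A\<^esub> k"] hB(1) hC(1)) auto
    show "x \<otimes>\<^bsub>?D\<^esub> y \<in> carrier ?D"
      unfolding xy biamalg_simps using m
      by (intro biamalg_setI[where i = "i \<otimes>\<^bsub>A\<^esub> k"] hB(2) hC(2)) auto
  qed
  have zero: "\<zero>\<^bsub>?D\<^esub> \<in> carrier ?D"
    unfolding biamalg_simps
    by (intro biamalg_setI[where i = "\<zero>\<^bsub>A\<^esub>"])
      (auto intro!: bexI[of _ "\<zero>\<^bsub>B\<^esub>"] bexI[of _ "\<zero>\<^bsub>C\<^esub>"])
  have one: "\<one>\<^bsub>?D\<^esub> \<in> carrier ?D"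
    unfolding biamalg_simps
    by (intro biamalg_setI[where i = "\<one>\<^bsub>A\<^esub>"])
      (auto intro!: bexI[of _ "\<zero>\<^bsub>B\<^esub>"] bexI[of _ "\<zero>\<^bsub>C\<^esub>"])
  have inv: "\<exists>y\<in>carrier ?D. y \<oplus>\<^bsub>?D\<^esub> x = \<zero>\<^bsub>?D\<^esub>" if "x \<in> carrier ?D" for x
  proof -
    from that obtain i j j' where x: "x = (f i \<oplus>\<^bsub>B\<^esub> j, g i \<oplus>\<^bsub>C\<^esub> j')"
      and m: "i \<in> carrier A" "j \<in> J" "j' \<in> J'"
      unfolding biamalg_simps by (elim biamalg_set_cases) blast
    obtain l l' where l: "l \<in> J" "f (\<ominus>\<^bsub>A\<^esub> i) \<oplus>\<^bsub>B\<^esub> l \<oplus>\<^bsub>B\<^esub> (f i \<oplus>\<^bsub>B\<^esub> j) = \<zero>\<^bsub>B\<^esub>"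
      and l': "l' \<in> J'" "g (\<ominus>\<^bsub>A\<^esub> i) \<oplus>\<^bsub>C\<^esub> l' \<oplus>\<^bsub>C\<^esub> (g i \<oplus>\<^bsub>C\<^esub> j') = \<zero>\<^bsub>C\<^esub>"
      using hB(3)[OF m(1) m(1) m(2) m(2)] hC(3)[OF m(1) m(1) m(3) m(3)] by blast
    have "(f (\<ominus>\<^bsub>A\<^esub> i) \<oplus>\<^bsub>B\<^esub> l, g (\<ominus>\<^bsub>A\<^esub> i) \<oplus>\<^bsub>C\<^esub> l') \<in> carrier ?D"
      unfolding biamalg_simps using l(1) l'(1) m(1)
      by (intro biamalg_setI[where i = "\<ominus>\<^bsub>A\<^esub> i"]) auto
    moreover have "(f (\<ominus>\<^bsub>A\<^esub> i) \<oplus>\<^bsub>B\<^esub> l, g (\<ominus>\<^bsub>A\<^esub> i) \<oplus>\<^bsub>C\<^esub> l') \<oplus>\<^bsub>?D\<^esub> x = \<zero>\<^bsub>?D\<^esub>"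
      by (simp only: x biamalg_simps l(2) l'(2))
    ultimately show ?thesis
      by blast
  qed
  show ?thesis
  proof (rule cringI)
    show "abelian_group ?D"
    proof (rule abelian_groupI)
      fix x y z assume "x \<in> carrier ?D" "y \<in> carrier ?D" "z \<in> carrier ?D"
      then show "x \<oplus>\<^bsub>?D\<^esub> y \<oplus>\<^bsub>?D\<^esub> z = x \<oplus>\<^bsub>?D\<^esub> (y \<oplus>\<^bsub>?D\<^esub> z)"
        by (auto dest!: pair simp: biamalg_simps(2-) B.a_assoc C.a_assoc)
    next
      fix x y assume "x \<in> carrier ?D" "y \<in> carrier ?D"
      then show "x \<oplus>\<^bsub>?D\<^esub> y = y \<oplus>\<^bsub>?D\<^esub> x"
        by (auto dest!: pair simp: biamalg_simps(2-) B.a_comm C.a_comm)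
    next
      fix x assume "x \<in> carrier ?D"
      then show "\<zero>\<^bsub>?D\<^esub> \<oplus>\<^bsub>?D\<^esub> x = x"
        by (auto dest!: pair simp: biamalg_simps(2-))
    qed (fact add zero inv)+
    show "comm_monoid ?D"
    proof (rule comm_monoidI)
      fix x y z assume "x \<in> carrier ?D" "y \<in> carrier ?D" "z \<in> carrier ?D"
      then show "x \<otimes>\<^bsub>?D\<^esub> y \<otimes>\<^bsub>?D\<^esub> z = x \<otimes>\<^bsub>?D\<^esub> (y \<otimes>\<^bsub>?D\<^esub> z)"
        by (auto dest!: pair simp: biamalg_simps(2-) B.m_assoc C.m_assoc)
    next
      fix x y assume "x \<in> carrier ?D" "y \<in> carrier ?D"
      then show "x \<otimes>\<^bsub>?D\<^esub> y = y \<otimes>\<^bsub>?D\<^esub> x"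
        by (auto dest!: pair simp: biamalg_simps(2-) B.m_comm C.m_comm)
    next
      fix x assume "x \<in> carrier ?D"
      then show "\<one>\<^bsub>?D\<^esub> \<otimes>\<^bsub>?D\<^esub> x = x"
        by (auto dest!: pair simp: biamalg_simps(2-))
    qed (fact mult one)+
    fix x y z assume "x \<in> carrier ?D" "y \<in> carrier ?D" "z \<in> carrier ?D"
    then show "(x \<oplus>\<^bsub>?D\<^esub> y) \<otimes>\<^bsub>?D\<^esub> z = x \<otimes>\<^bsub>?D\<^esub> z \<oplus>\<^bsub>?D\<^esub> y \<otimes>\<^bsub>?D\<^esub> z"
      by (auto dest!: pair simp: biamalg_simps(2-) B.l_distr C.l_distr)
  qed
qed

lemma biamalg_primeideal:
  assumes "cring A" "cring B" "cring C" "f \<in> ring_hom A B" "g \<in> ring_hom A C"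
    and "ideal J B" "ideal J' C" and "primeideal p A" "{a \<in> carrier A. f a \<in> J} \<subseteq> p"
  shows "primeideal (biamalg_set B C f g p J J') (biamalg A B C f g J J')"
proof -
  let ?D = "biamalg A B C f g J J'" and ?P = "biamalg_set B C f g p J J'"
  interpret A: cring A by fact
  interpret B: cring B by fact
  interpret C: cring C by fact
  interpret D: cring ?D
    using assms by (intro biamalg_cring)
  interpret J: ideal J B by fact
  interpret J': ideal J' C by fact
  interpret p: primeideal p A by fact
  note hB = hom_plus_ideal[OF assms(1,2,4,6)] and hC = hom_plus_ideal[OF assms(1,3,5,7)]
  have pc: "a \<in> carrier A" if "a \<in> p" for a
    using that by (rule p.a_Hcarr)
  have in_p: "a \<in> p"
    if "(f a \<oplus>\<^bsub>B\<^esub> j, g a \<oplus>\<^bsub>C\<^esub> j') \<in> ?P" "a \<in> carrier A" "j \<in> J" for a j j'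
  proof -
    from that(1) obtain q k where q: "q \<in> p" "k \<in> J" "f a \<oplus>\<^bsub>B\<^esub> j = f q \<oplus>\<^bsub>B\<^esub> k"
      by (elim biamalg_set_cases) auto
    have "f (a \<ominus>\<^bsub>A\<^esub> q) \<in> J"
      using hB(4)[OF that(2) pc[OF q(1)] that(3) q(2,3)] .
    then have "a \<ominus>\<^bsub>A\<^esub> q \<in> p"
      using assms(9) that(2) pc[OF q(1)] by auto
    then have "(a \<ominus>\<^bsub>A\<^esub> q) \<oplus>\<^bsub>A\<^esub> q \<in> p"
      using q(1) by (rule p.a_closed)
    moreover have "(a \<ominus>\<^bsub>A\<^esub> q) \<oplus>\<^bsub>A\<^esub> q = a"
      using that(2) pc[OF q(1)] by algebra
    ultimately show ?thesis by simp
  qed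
  have sub: "?P \<subseteq> carrier ?D"
    using pc unfolding biamalg_simps biamalg_set_def by blast
  have l_closed: "y \<otimes>\<^bsub>?D\<^esub> x \<in> ?P" if "x \<in> ?P" "y \<in> carrier ?D" for x y
  proof -
    from that obtain i j j' k l l' where xy: "y = (f i \<oplus>\<^bsub>B\<^esub> j, g i \<oplus>\<^bsub>C\<^esub> j')"
        "x = (f k \<oplus>\<^bsub>B\<^esub> l, g k \<oplus>\<^bsub>C\<^esub> l')"
      and m: "i \<in> carrier A" "j \<in> J" "j' \<in> J'" "k \<in> p" "l \<in> J" "l' \<in> J'"
      unfolding biamalg_simps by (elim biamalg_set_cases) blast
    show ?thesis
      unfolding xy biamalg_simps using m
      by (intro biamalg_setI[where i = "i \<otimes>\<^bsub>A\<^esub> k"] hB(2) hC(2) p.I_l_closed) (auto intro: pc)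
  qed
  have add: "x \<oplus>\<^bsub>?D\<^esub> y \<in> ?P" if "x \<in> ?P" "y \<in> ?P" for x y
  proof -
    from that obtain i j j' k l l' where xy: "x = (f i \<oplus>\<^bsub>B\<^esub> j, g i \<oplus>\<^bsub>C\<^esub> j')"
        "y = (f k \<oplus>\<^bsub>B\<^esub> l, g k \<oplus>\<^bsub>C\<^esub> l')"
      and m: "i \<in> p" "j \<in> J" "j' \<in> J'" "k \<in> p" "l \<in> J" "l' \<in> J'"
      by (elim biamalg_set_cases) blast
    show ?thesis
      unfolding xy biamalg_simps using m
      by (intro biamalg_setI[where i = "i \<oplus>\<^bsub>A\<^esub> k"] hB(1) hC(1) p.a_closed) (auto intro: pc)
  qed
  have ideal: "ideal ?P ?D"
  proof (rule idealI[OF D.ring_axioms])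
    show "subgroup ?P (add_monoid ?D)"
    proof (rule group.subgroupI[OF D.a_group])
      show "?P \<subseteq> carrier (add_monoid ?D)"
        using sub by simp
      show "?P \<noteq> {}"
        unfolding biamalg_set_def
        using p.zero_closed J.zero_closed J'.zero_closed by blast
    next
      fix x assume x: "x \<in> ?P"
      then have "(\<ominus>\<^bsub>?D\<^esub> \<one>\<^bsub>?D\<^esub>) \<otimes>\<^bsub>?D\<^esub> x \<in> ?P"
        by (intro l_closed) auto
      moreover have "(\<ominus>\<^bsub>?D\<^esub> \<one>\<^bsub>?D\<^esub>) \<otimes>\<^bsub>?D\<^esub> x = \<ominus>\<^bsub>?D\<^esub> x"
        using x sub by (simp add: D.l_minus subsetD)
      ultimately show "inv\<^bsub>add_monoid ?D\<^esub> x \<in> ?P"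
        by (simp add: a_inv_def)
    qed (use add in simp)
    fix x y assume m: "x \<in> ?P" "y \<in> carrier ?D"
    show "y \<otimes>\<^bsub>?D\<^esub> x \<in> ?P"
      using m by (rule l_closed)
    then show "x \<otimes>\<^bsub>?D\<^esub> y \<in> ?P"
      using D.m_comm[OF subsetD[OF sub m(1)] m(2)] by simp
  qed
  show ?thesis
  proof (rule primeidealI[OF ideal D.is_cring])
    show "carrier ?D \<noteq> ?P"
    proof
      assume eq: "carrier ?D = ?P"
      have "carrier A \<subseteq> p"
      proof
        fix a assume a: "a \<in> carrier A"
        then have "(f a \<oplus>\<^bsub>B\<^esub> \<zero>\<^bsub>B\<^esub>, g a \<oplus>\<^bsub>C\<^esub> \<zero>\<^bsub>C\<^esub>) \<in> carrier ?D"
          unfolding biamalg_simps biamalg_set_def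
          using J.zero_closed J'.zero_closed by blast
        then have "(f a \<oplus>\<^bsub>B\<^esub> \<zero>\<^bsub>B\<^esub>, g a \<oplus>\<^bsub>C\<^esub> \<zero>\<^bsub>C\<^esub>) \<in> ?P"
          unfolding eq .
        then show "a \<in> p"
          using a J.zero_closed by (rule in_p)
      qed
      then show False
        using p.I_notcarr pc by blast
    qed
  next
    fix x y assume "x \<in> carrier ?D" "y \<in> carrier ?D" and prod: "x \<otimes>\<^bsub>?D\<^esub> y \<in> ?P"
    then obtain i j j' k l l' where xy: "x = (f i \<oplus>\<^bsub>B\<^esub> j, g i \<oplus>\<^bsub>C\<^esub> j')"
        "y = (f k \<oplus>\<^bsub>B\<^esub> l, g k \<oplus>\<^bsub>C\<^esub> l')"
      and m: "i \<in> carrier A" "j \<in> J" "j' \<in> J'" "k \<in> carrier A" "l \<in> J" "l' \<in> J'"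
      unfolding biamalg_simps by (elim biamalg_set_cases) blast
    obtain n n' where n: "n \<in> J" "(f i \<oplus>\<^bsub>B\<^esub> j) \<otimes>\<^bsub>B\<^esub> (f k \<oplus>\<^bsub>B\<^esub> l) = f (i \<otimes>\<^bsub>A\<^esub> k) \<oplus>\<^bsub>B\<^esub> n"
      and n': "n' \<in> J'" "(g i \<oplus>\<^bsub>C\<^esub> j') \<otimes>\<^bsub>C\<^esub> (g k \<oplus>\<^bsub>C\<^esub> l') = g (i \<otimes>\<^bsub>A\<^esub> k) \<oplus>\<^bsub>C\<^esub> n'"
      using hB(2)[OF m(1,4,2,5)] hC(2)[OF m(1,4,3,6)] by blast
    have "i \<otimes>\<^bsub>A\<^esub> k \<in> p"
      using prod m(1,4) n(1) unfolding xy biamalg_simps n(2) n'(2) by (intro in_p) auto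
    then have "i \<in> p \<or> k \<in> p"
      using p.I_prime m(1,4) by blast
    then show "x \<in> ?P \<or> y \<in> ?P"
      unfolding xy biamalg_set_def using m by blast
  qed
qed

end

theory Submission
  imports Defs
begin

text \<open>Let \<open>D\<close> be the bi-amalgamation and \<open>T\<close> the complement of \<open>P\<close>. The projections of \<open>D\<close> map \<open>T\<close> into
  \<open>S\<close> and \<open>S'\<close>, so they induce a homomorphism from \<open>T\<^sup>-\<^sup>1D\<close> to \<open>S\<^sup>-\<^sup>1B \<times> S'\<^sup>-\<^sup>1C\<close>, and
  \<open>(f a + j)/(f t + k)\<close> differs from \<open>f a/f t\<close> by an element of \<open>S\<^sup>-\<^sup>1J\<close>. For surjectivity,
  \<open>(j/(f u + k), 0)\<close> is the image of \<open>(j, 0)/(f u + k, g u)\<close>. For injectivity, if \<open>w = f u + k\<close>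
  kills \<open>b\<close> and \<open>w' = g v + k'\<close> kills \<open>c\<close>, then \<open>(w, g u)(f v, w')\<close> lies in \<open>T\<close> and kills \<open>(b, c)\<close>.\<close>

section \<open>Zero fractions and extended ideals\<close>

lemma mem_image_set_add_iff:
  "x \<in> h ` U <+>\<^bsub>B\<^esub> J \<longleftrightarrow> (\<exists>s\<in>U. \<exists>j\<in>J. x = h s \<oplus>\<^bsub>B\<^esub> j)"
  unfolding set_add_def' by auto

text \<open>Zero is \<open>\<zero>/\<one>\<close>, so cross multiplication leaves only
  \<open>u \<otimes> a\<close> on one side. This turns a vanishing fraction into an annihilator of
  its numerator, which is what the injectivity argument works with.\<close>

lemma (in mult_subset) fraction_eq_zero_iff:
  assumes "a \<in> carrier R" "s \<in> S"
  shows "fraction R S a s = \<zero>\<^bsub>fraction_ring R S\<^esub> \<longleftrightarrow> (\<exists>u\<in>S. u \<otimes> a = \<zero>)"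
  unfolding fraction_zero using assms S_carr by (subst fraction_eq_iff) auto

lemma (in mult_subset) fraction_zero_numerator:
  "s \<in> S \<Longrightarrow> fraction R S \<zero> s = \<zero>\<^bsub>fraction_ring R S\<^esub>"
  using fraction_eq_zero_iff[of \<zero> s] S.one_closed by auto

lemma (in mult_subset) extended_ideal_ideal:
  assumes "ideal J R"
  shows "ideal (extended_ideal R S J) (fraction_ring R S)"
proof -
  interpret J: ideal J R by fact
  interpret Q: cring "fraction_ring R S" by (rule fraction_ring_cring)
  show ?thesis
    unfolding extended_ideal_eq_genideal[OF assms]
    using J.a_Hcarr by (intro Q.genideal_ideal) (auto intro: fraction_closed)
qed

section \<open>Membership in the prime ideal and the projections of the bi-amalgamation\<close>

text \<open>The element \<open>a\<close> in a presentation of a pair is not unique, but two choices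
  \<open>a\<close> and \<open>q\<close> satisfy \<open>h (a - q) \<in> J\<close> with
  \<open>h = f\<close>, so they differ by an element of \<open>p\<close>. Hence whether a pair lies
  in the prime ideal can be read off from any presentation.\<close>

lemma mem_biamalg_set_iff:
  assumes "cring A" "cring B" "f \<in> ring_hom A B" "ideal J B"
    and "ideal p A" "{a \<in> carrier A. f a \<in> J} \<subseteq> p"
    and "a \<in> carrier A" "j \<in> J" "j' \<in> J'"
  shows "(f a \<oplus>\<^bsub>B\<^esub> j, g a \<oplus>\<^bsub>C\<^esub> j') \<in> biamalg_set B C f g p J J' \<longleftrightarrow> a \<in> p"
proof
  assume "(f a \<oplus>\<^bsub>B\<^esub> j, g a \<oplus>\<^bsub>C\<^esub> j') \<in> biamalg_set B C f g p J J'"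
  then obtain q k where q: "q \<in> p" "k \<in> J" "f a \<oplus>\<^bsub>B\<^esub> j = f q \<oplus>\<^bsub>B\<^esub> k"
    by (elim biamalg_set_cases) auto
  interpret A: cring A by fact
  interpret p: ideal p A by fact
  have qc: "q \<in> carrier A"
    using q(1) by (rule p.a_Hcarr)
  have "a \<ominus>\<^bsub>A\<^esub> q \<in> p"
    using hom_plus_ideal(4)[OF assms(1-4,7) qc assms(8) q(2,3)] assms(6,7) qc by auto
  then have "(a \<ominus>\<^bsub>A\<^esub> q) \<oplus>\<^bsub>A\<^esub> q \<in> p"
    using q(1) by (rule p.a_closed)
  moreover have "(a \<ominus>\<^bsub>A\<^esub> q) \<oplus>\<^bsub>A\<^esub> q = a"
    using assms(7) qc by algebra
  ultimately show "a \<in> p" by simp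
qed (use assms in \<open>auto simp: biamalg_set_def\<close>)

lemma biamalg_proj_hom:
  assumes "cring A" "cring B" "cring C" "f \<in> ring_hom A B" "g \<in> ring_hom A C"
    and "ideal J B" "ideal J' C"
  shows "fst \<in> ring_hom (biamalg A B C f g J J') B"
    and "snd \<in> ring_hom (biamalg A B C f g J J') C"
proof -
  have "fst x \<in> carrier B" "snd x \<in> carrier C" if "x \<in> carrier (biamalg A B C f g J J')" for x
    using that hom_plus_ideal(5)[OF assms(1,2,4,6)] hom_plus_ideal(5)[OF assms(1,3,5,7)]
    unfolding biamalg_simps biamalg_set_def by auto
  then show "fst \<in> ring_hom (biamalg A B C f g J J') B"
    and "snd \<in> ring_hom (biamalg A B C f g J J') C"
    by (auto intro!: ring_hom_memI simp: biamalg_simps(2-))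
qed

section \<open>Preimages of the extended ideals\<close>

text \<open>If \<open>h a / h t\<close> is a fraction \<open>j/s\<close> with \<open>j\<close> in
  \<open>J\<close>, clearing denominators puts a multiple of \<open>h a\<close> by an element of
  \<open>S\<close> into \<open>J\<close>. Modulo \<open>J\<close> that multiplier is
  \<open>h u\<close> with \<open>u\<close> outside \<open>p\<close>, so \<open>u a\<close> lies in
  the preimage of \<open>J\<close>. Stated for a general \<open>h\<close>, this serves both
  \<open>f\<close> and \<open>g\<close>.\<close>

lemma induced_map_vimage_extended_ideal:
  assumes "cring A" "cring B" "h \<in> ring_hom A B" "ideal J B" "primeideal p A"
    and "S = h ` (carrier A - p) <+>\<^bsub>B\<^esub> J"
  shows "{x \<in> carrier (localization A p). induced_map B S h x \<in> extended_ideal B S J} =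
    extended_ideal A (carrier A - p) {a \<in> carrier A. h a \<in> J}" (is "?L = ?R")
proof -
  let ?U = "carrier A - p"
  interpret A: mult_subset A ?U
    by (rule mult_subset_complement) fact
  note im = mult_subset_image[OF assms(1-5), folded assms(6)]
  interpret B: mult_subset B S
    by (rule im)
  interpret J: ideal J B by fact
  interpret h: ring_hom_cring A B h
    using assms by (intro ring_hom_cring.intro ring_hom_cring_axioms.intro) auto
  note ind = induced_map_fraction[OF A.mult_subset_axioms im(1) assms(3) im(2)]
  have hS: "h s \<in> S" if "s \<in> ?U" for s
    using im(2) that by auto
  show ?thesis
  proof (intro equalityI subsetI)
    fix x assume "x \<in> ?R"
    then obtain a t where x: "x = fraction A ?U a t" and a: "a \<in> carrier A" "h a \<in> J"
      and t: "t \<in> ?U"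
      unfolding extended_ideal_def by blast
    have "induced_map B S h x = fraction B S (h a) (h t)"
      unfolding x by (rule ind) fact+
    moreover have "x \<in> carrier (localization A p)"
      unfolding x localization_def using a(1) t by (rule A.fraction_closed)
    ultimately show "x \<in> ?L"
      using a(2) hS[OF t] by (auto simp: extended_ideal_def)
  next
    fix x assume x: "x \<in> ?L"
    then obtain a t where xf: "x = fraction A ?U a t" and a: "a \<in> carrier A" and t: "t \<in> ?U"
      unfolding localization_def by (blast elim: A.fraction_cases)
    have "fraction B S (h a) (h t) \<in> extended_ideal B S J"
      using x ind[OF a t] unfolding xf by simp
    then obtain j s where j: "j \<in> J" and s: "s \<in> S"
      and eq: "fraction B S (h a) (h t) = fraction B S j s"
      unfolding extended_ideal_def by blast
    have jc: "j \<in> carrier B"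
      using j by (rule J.a_Hcarr)
    obtain w where w: "w \<in> S" "w \<otimes>\<^bsub>B\<^esub> (s \<otimes>\<^bsub>B\<^esub> h a) = w \<otimes>\<^bsub>B\<^esub> (h t \<otimes>\<^bsub>B\<^esub> j)"
      using eq B.fraction_eq_iff[OF h.hom_closed[OF a] jc hS[OF t] s] by auto
    \<comment> \<open>The whole multiplier of \<open>h a\<close> is written as
      \<open>h u + k\<close> at once, which gives a single \<open>u\<close> outside
      \<open>p\<close>.\<close>
    have "w \<otimes>\<^bsub>B\<^esub> s \<in> S"
      using w(1) s by (rule B.S.m_closed)
    then obtain u k where u: "u \<in> ?U" and k: "k \<in> J" and ws: "w \<otimes>\<^bsub>B\<^esub> s = h u \<oplus>\<^bsub>B\<^esub> k"
      unfolding assms(6) mem_image_set_add_iff by blast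
    have c: "h u \<in> carrier B" "h a \<in> carrier B" "k \<in> carrier B" "w \<in> carrier B" "s \<in> carrier B"
      "h t \<in> carrier B"
      using u k a w s t B.S_carr J.a_Hcarr by auto
    \<comment> \<open>Adding and subtracting \<open>k\<close> times \<open>h a\<close> brings in
      \<open>w s = h u + k\<close>; then the relation for \<open>w\<close> replaces
      \<open>w s (h a)\<close> by a multiple of \<open>j\<close>.\<close>
    have "h u \<otimes>\<^bsub>B\<^esub> h a = (h u \<oplus>\<^bsub>B\<^esub> k) \<otimes>\<^bsub>B\<^esub> h a \<oplus>\<^bsub>B\<^esub> (\<ominus>\<^bsub>B\<^esub> k) \<otimes>\<^bsub>B\<^esub> h a"
      using c by algebra
    also have "(h u \<oplus>\<^bsub>B\<^esub> k) \<otimes>\<^bsub>B\<^esub> h a = w \<otimes>\<^bsub>B\<^esub> (h t \<otimes>\<^bsub>B\<^esub> j)"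
      unfolding ws[symmetric] w(2)[symmetric] using c by algebra
    finally have "h (u \<otimes>\<^bsub>A\<^esub> a) = w \<otimes>\<^bsub>B\<^esub> (h t \<otimes>\<^bsub>B\<^esub> j) \<oplus>\<^bsub>B\<^esub> (\<ominus>\<^bsub>B\<^esub> k) \<otimes>\<^bsub>B\<^esub> h a"
      using u a by simp
    moreover have "w \<otimes>\<^bsub>B\<^esub> (h t \<otimes>\<^bsub>B\<^esub> j) \<oplus>\<^bsub>B\<^esub> (\<ominus>\<^bsub>B\<^esub> k) \<otimes>\<^bsub>B\<^esub> h a \<in> J"
      using c j k by (intro J.a_closed J.I_l_closed J.I_r_closed J.a_inv_closed) auto
    ultimately have "h (u \<otimes>\<^bsub>A\<^esub> a) \<in> J"
      by simp
    moreover have ut: "u \<otimes>\<^bsub>A\<^esub> t \<in> ?U"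
      using u t by (rule A.S.m_closed)
    \<comment> \<open>Expanding \<open>a/t\<close> by \<open>u\<close> gives a numerator in the
      preimage of \<open>J\<close>; the numerator \<open>a\<close> itself need not lie
      there.\<close>
    moreover have "x = fraction A ?U (u \<otimes>\<^bsub>A\<^esub> a) (u \<otimes>\<^bsub>A\<^esub> t)"
      unfolding xf
    proof (rule A.fraction_eqI[OF a _ t ut])
      have "u \<in> carrier A" "t \<in> carrier A" using u t by auto
      then show "u \<otimes>\<^bsub>A\<^esub> a \<in> carrier A" "u \<otimes>\<^bsub>A\<^esub> t \<otimes>\<^bsub>A\<^esub> a = t \<otimes>\<^bsub>A\<^esub> (u \<otimes>\<^bsub>A\<^esub> a)"
        using a by (simp, algebra)
    qed
    ultimately show "x \<in> ?R"
      unfolding extended_ideal_def using u a by blast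
  qed
qed

section \<open>The isomorphism of the localized bi-amalgamation\<close>

text \<open>Subtracting \<open>h a / h t\<close> cancels the term \<open>h t (h a)\<close> and
  leaves a numerator in \<open>J\<close>. Applied in each component, this shows that the map on
  fractions lands in the bi-amalgamation over the localization of \<open>A\<close>.\<close>

lemma fraction_hom_plus_ideal:
  assumes "cring A" "cring B" "h \<in> ring_hom A B" "ideal J B" "primeideal p A"
    and "S = h ` (carrier A - p) <+>\<^bsub>B\<^esub> J"
    and "a \<in> carrier A" "t \<in> carrier A - p" "j \<in> J" "k \<in> J"
  shows "\<exists>l\<in>extended_ideal B S J. fraction B S (h a \<oplus>\<^bsub>B\<^esub> j) (h t \<oplus>\<^bsub>B\<^esub> k) =
    induced_map B S h (fraction A (carrier A - p) a t) \<oplus>\<^bsub>fraction_ring B S\<^esub> l"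
proof -
  let ?U = "carrier A - p"
  interpret A: mult_subset A ?U
    by (rule mult_subset_complement) fact
  note im = mult_subset_image[OF assms(1-5), folded assms(6)]
  interpret B: mult_subset B S
    by (rule im)
  interpret J: ideal J B by fact
  interpret h: ring_hom_cring A B h
    using assms by (intro ring_hom_cring.intro ring_hom_cring_axioms.intro) auto
  note ind = induced_map_fraction[OF A.mult_subset_axioms im(1) assms(3) im(2) assms(7,8)]
  have ht: "h t \<in> S"
    using assms(8) im(2) by auto
  have d: "h t \<oplus>\<^bsub>B\<^esub> k \<in> S"
    using assms(8,10) unfolding assms(6) mem_image_set_add_iff by auto
  have c: "h a \<in> carrier B" "h t \<in> carrier B" "j \<in> carrier B" "k \<in> carrier B"
    using assms(7-10) J.a_Hcarr by auto
  \<comment> \<open>\<open>?n/?e\<close> is the difference of the two fractions: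
    \<open>h t (h a + j) - (h t + k) (h a)\<close> simplifies to \<open>?n\<close>.\<close>
  let ?n = "h t \<otimes>\<^bsub>B\<^esub> j \<oplus>\<^bsub>B\<^esub> (\<ominus>\<^bsub>B\<^esub> k) \<otimes>\<^bsub>B\<^esub> h a" and ?e = "h t \<otimes>\<^bsub>B\<^esub> (h t \<oplus>\<^bsub>B\<^esub> k)"
  have n: "?n \<in> J"
    using c assms(9,10) by (intro J.a_closed J.I_l_closed J.I_r_closed J.a_inv_closed)
  have e: "?e \<in> S"
    using ht d by (rule B.S.m_closed)
  have "fraction B S (h a \<oplus>\<^bsub>B\<^esub> j) (h t \<oplus>\<^bsub>B\<^esub> k) =
      fraction B S (?e \<otimes>\<^bsub>B\<^esub> h a \<oplus>\<^bsub>B\<^esub> h t \<otimes>\<^bsub>B\<^esub> ?n) (h t \<otimes>\<^bsub>B\<^esub> ?e)"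
  proof (rule B.fraction_eqI)
    show "h t \<otimes>\<^bsub>B\<^esub> ?e \<otimes>\<^bsub>B\<^esub> (h a \<oplus>\<^bsub>B\<^esub> j) =
        (h t \<oplus>\<^bsub>B\<^esub> k) \<otimes>\<^bsub>B\<^esub> (?e \<otimes>\<^bsub>B\<^esub> h a \<oplus>\<^bsub>B\<^esub> h t \<otimes>\<^bsub>B\<^esub> ?n)"
      using c by algebra
  qed (use c ht d e in auto)
  also have "\<dots> = fraction B S (h a) (h t) \<oplus>\<^bsub>fraction_ring B S\<^esub> fraction B S ?n ?e"
    using c ht e by (subst B.fraction_add) auto
  finally show ?thesis
    unfolding ind extended_ideal_def using n e by blast
qed

lemma localization_biamalg_iso:
  assumes "cring A" "cring B" "cring C" "f \<in> ring_hom A B" "g \<in> ring_hom A C"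
    and "ideal J B" "ideal J' C" "primeideal p A" "{a \<in> carrier A. f a \<in> J} \<subseteq> p"
    and P: "P = biamalg_set B C f g p J J'"
    and S: "S = f ` (carrier A - p) <+>\<^bsub>B\<^esub> J"
    and S': "S' = g ` (carrier A - p) <+>\<^bsub>C\<^esub> J'"
  shows "localization (biamalg A B C f g J J') P \<simeq>
    biamalg (localization A p) (fraction_ring B S) (fraction_ring C S')
      (induced_map B S f) (induced_map C S' g) (extended_ideal B S J) (extended_ideal C S' J')"
proof -
  let ?D = "biamalg A B C f g J J'"
  let ?T = "carrier ?D - P" and ?U = "carrier A - p"
  let ?Q = "fraction_ring ?D ?T" and ?BS = "fraction_ring B S" and ?CS = "fraction_ring C S'"
  let ?E = "biamalg (localization A p) ?BS ?CS (induced_map B S f) (induced_map C S' g)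
    (extended_ideal B S J) (extended_ideal C S' J')"
  let ?\<phi> = "\<lambda>X. (induced_map B S fst X, induced_map C S' snd X)"
  interpret p: primeideal p A by fact
  interpret J: ideal J B by fact
  interpret J': ideal J' C by fact
  note zJ = additive_subgroup.zero_closed[OF J.additive_subgroup_axioms]
    and zJ' = additive_subgroup.zero_closed[OF J'.additive_subgroup_axioms]
  interpret U: mult_subset A ?U
    by (rule mult_subset_complement) fact
  interpret f: ring_hom_cring A B f
    using assms by (intro ring_hom_cring.intro ring_hom_cring_axioms.intro) auto
  interpret g: ring_hom_cring A C g
    using assms by (intro ring_hom_cring.intro ring_hom_cring_axioms.intro) auto
  have "primeideal P ?D"
    unfolding P using assms by (intro biamalg_primeideal) auto
  then interpret T: mult_subset ?D ?T
    by (rule mult_subset_complement)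
  note imB = mult_subset_image[OF assms(1,2,4,6,8), folded S]
    and imC = mult_subset_image[OF assms(1,3,5,7,8), folded S']
  interpret BS: mult_subset B S by (rule imB)
  interpret CS: mult_subset C S' by (rule imC)
  interpret Q: cring ?Q by (rule T.fraction_ring_cring)
  interpret BQ: cring ?BS by (rule BS.fraction_ring_cring)
  interpret CQ: cring ?CS by (rule CS.fraction_ring_cring)
  interpret AQ: cring "localization A p"
    unfolding localization_def by (rule U.fraction_ring_cring)
  interpret JS: ideal "extended_ideal B S J" ?BS
    by (rule BS.extended_ideal_ideal) fact
  interpret JS': ideal "extended_ideal C S' J'" ?CS
    by (rule CS.extended_ideal_ideal) fact
  have homA: "induced_map B S f \<in> ring_hom (localization A p) ?BS"
      "induced_map C S' g \<in> ring_hom (localization A p) ?CS"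
    unfolding localization_def
    using U.mult_subset_axioms imB imC assms(4,5) by (auto intro: induced_map_hom)
  interpret E: cring ?E
    using homA by (intro biamalg_cring JS.is_ideal JS'.is_ideal) unfold_locales
  note mem_P = mem_biamalg_set_iff[OF assms(1,2,4,6) p.is_ideal assms(9), where J' = J' and g = g and C = C, folded P]
  have zA: "\<zero>\<^bsub>A\<^esub> \<in> carrier A"
    by simp
  have DI: "(f a \<oplus>\<^bsub>B\<^esub> j, g a \<oplus>\<^bsub>C\<^esub> j') \<in> carrier ?D"
    if "a \<in> carrier A" "j \<in> J" "j' \<in> J'" for a j j'
    using that unfolding biamalg_simps biamalg_set_def by blast
  \<comment> \<open>With \<open>\<zero>\<close> for one of \<open>j\<close>, \<open>j'\<close>, this
    completes a given element of \<open>S\<close> or of \<open>S'\<close> to a pair in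
    \<open>?T\<close>.\<close>
  have TI: "(f a \<oplus>\<^bsub>B\<^esub> j, g a \<oplus>\<^bsub>C\<^esub> j') \<in> ?T" if "a \<in> ?U" "j \<in> J" "j' \<in> J'" for a j j'
    using that DI mem_P by auto
  have TE: "\<exists>a j j'. x = (f a \<oplus>\<^bsub>B\<^esub> j, g a \<oplus>\<^bsub>C\<^esub> j') \<and> a \<in> ?U \<and> j \<in> J \<and> j' \<in> J'"
    if "x \<in> ?T" for x
    using that unfolding P biamalg_simps biamalg_set_def by blast
  have TS: "fst x \<in> S" "snd x \<in> S'" if "x \<in> ?T" for x
    using TE[OF that] unfolding S S' mem_image_set_add_iff by fastforce+
  have sub: "fst ` ?T \<subseteq> S" "snd ` ?T \<subseteq> S'"
    using TS by auto
  note proj = biamalg_proj_hom[OF assms(1-7)]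
  note ind = induced_map_fraction[OF T.mult_subset_axioms imB(1) proj(1) sub(1)]
    induced_map_fraction[OF T.mult_subset_axioms imC(1) proj(2) sub(2)]
  have F: "induced_map B S fst \<in> ring_hom ?Q ?BS" and G: "induced_map C S' snd \<in> ring_hom ?Q ?CS"
    by (intro induced_map_hom T.mult_subset_axioms imB imC proj sub)+
  have \<phi>_closed: "?\<phi> x \<in> carrier ?E" if x: "x \<in> carrier ?Q" for x
  proof -
    obtain d e where xf: "x = fraction ?D ?T d e" and d: "d \<in> carrier ?D" and e: "e \<in> ?T"
      using x by (rule T.fraction_cases)
    obtain a j j' where d': "d = (f a \<oplus>\<^bsub>B\<^esub> j, g a \<oplus>\<^bsub>C\<^esub> j')" "a \<in> carrier A" "j \<in> J" "j' \<in> J'"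
      using d unfolding biamalg_simps by (elim biamalg_set_cases)
    obtain t k k' where e': "e = (f t \<oplus>\<^bsub>B\<^esub> k, g t \<oplus>\<^bsub>C\<^esub> k')" "t \<in> ?U" "k \<in> J" "k' \<in> J'"
      using TE[OF e] by blast
    \<comment> \<open>Both components of \<open>d\<close> share \<open>a\<close> and both components
      of \<open>e\<close> share \<open>t\<close>, so the one fraction \<open>a/t\<close> serves in
      both components of the image.\<close>
    have "fraction A ?U a t \<in> carrier (localization A p)"
      unfolding localization_def using d'(2) e'(2) by (rule U.fraction_closed)
    then show ?thesis
      unfolding xf ind[OF d e] unfolding biamalg_simps d'(1) e'(1) fst_conv snd_conv
      by (rule biamalg_setI)
        (rule fraction_hom_plus_ideal[OF assms(1,2,4,6,8) S d'(2) e'(2) d'(3) e'(3)]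
          fraction_hom_plus_ideal[OF assms(1,3,5,7,8) S' d'(2) e'(2) d'(4) e'(4)])+
  qed
  have \<phi>_hom: "?\<phi> \<in> ring_hom ?Q ?E"
    using \<phi>_closed ring_hom_mult[OF F] ring_hom_mult[OF G] ring_hom_add[OF F] ring_hom_add[OF G]
      ring_hom_one[OF F] ring_hom_one[OF G]
    by (intro ring_hom_memI) (auto simp: biamalg_simps(2-))
  interpret \<phi>: ring_hom_ring ?Q ?E ?\<phi>
    by (rule ring_hom_ringI2[OF Q.ring_axioms E.ring_axioms \<phi>_hom])
  have ker: "x = \<zero>\<^bsub>?Q\<^esub>" if x: "x \<in> carrier ?Q" and 0: "?\<phi> x = \<zero>\<^bsub>?E\<^esub>" for x
  proof -
    obtain d e where xf: "x = fraction ?D ?T d e" and d: "d \<in> carrier ?D" and e: "e \<in> ?T"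
      using x by (rule T.fraction_cases)
    have dc: "fst d \<in> carrier B" "snd d \<in> carrier C"
      using d ring_hom_closed[OF proj(1)] ring_hom_closed[OF proj(2)] by auto
    have "fraction B S (fst d) (fst e) = \<zero>\<^bsub>?BS\<^esub>" "fraction C S' (snd d) (snd e) = \<zero>\<^bsub>?CS\<^esub>"
      using 0 unfolding xf ind[OF d e] unfolding biamalg_simps by auto
    then obtain w w' where w: "w \<in> S" "w \<otimes>\<^bsub>B\<^esub> fst d = \<zero>\<^bsub>B\<^esub>" and w': "w' \<in> S'" "w' \<otimes>\<^bsub>C\<^esub> snd d = \<zero>\<^bsub>C\<^esub>"
      using BS.fraction_eq_zero_iff[OF dc(1) TS(1)[OF e]]
        CS.fraction_eq_zero_iff[OF dc(2) TS(2)[OF e]] by blast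
    obtain u k where u: "u \<in> ?U" "k \<in> J" "w = f u \<oplus>\<^bsub>B\<^esub> k"
      using w(1) unfolding S mem_image_set_add_iff by blast
    obtain v k' where v: "v \<in> ?U" "k' \<in> J'" "w' = g v \<oplus>\<^bsub>C\<^esub> k'"
      using w'(1) unfolding S' mem_image_set_add_iff by blast
    \<comment> \<open>The elements \<open>u\<close> and \<open>v\<close> are unrelated, so
      \<open>(w, w')\<close> need not lie in the bi-amalgamation. Each annihilator is therefore
      completed to its own pair, and the product of the two pairs contains \<open>w\<close> in the
      first component and \<open>w'\<close> in the second.\<close>
    have uT: "(w, g u) \<in> ?T"
      using TI[OF u(1,2) zJ'] u by auto
    have vT: "(f v, w') \<in> ?T"
      using TI[OF v(1) zJ v(2)] v by auto
    have c: "w \<in> carrier B" "f v \<in> carrier B" "w' \<in> carrier C" "g u \<in> carrier C"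
      using u v w w' BS.S_carr CS.S_carr by auto
    have "w \<otimes>\<^bsub>B\<^esub> f v \<otimes>\<^bsub>B\<^esub> fst d = f v \<otimes>\<^bsub>B\<^esub> (w \<otimes>\<^bsub>B\<^esub> fst d)"
      using c dc by algebra
    moreover have "g u \<otimes>\<^bsub>C\<^esub> w' \<otimes>\<^bsub>C\<^esub> snd d = g u \<otimes>\<^bsub>C\<^esub> (w' \<otimes>\<^bsub>C\<^esub> snd d)"
      using c dc by algebra
    ultimately have "((w, g u) \<otimes>\<^bsub>?D\<^esub> (f v, w')) \<otimes>\<^bsub>?D\<^esub> (fst d, snd d) = \<zero>\<^bsub>?D\<^esub>"
      using c by (simp add: biamalg_simps w w' del: prod.collapse)
    then show ?thesis
      unfolding xf T.fraction_eq_zero_iff[OF d e]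
      using T.S.m_closed[OF uT vT] by auto
  qed
  have onto: "\<exists>x\<in>carrier ?Q. ?\<phi> x = y" if y: "y \<in> carrier ?E" for y
  proof -
    obtain \<xi> l l' where y: "y = (induced_map B S f \<xi> \<oplus>\<^bsub>?BS\<^esub> l, induced_map C S' g \<xi> \<oplus>\<^bsub>?CS\<^esub> l')"
      and \<xi>: "\<xi> \<in> carrier (localization A p)"
      and l: "l \<in> extended_ideal B S J" and l': "l' \<in> extended_ideal C S' J'"
      using y unfolding biamalg_simps by (elim biamalg_set_cases)
    obtain a t where a: "\<xi> = fraction A ?U a t" "a \<in> carrier A" "t \<in> ?U"
      using \<xi> unfolding localization_def by (rule U.fraction_cases)
    obtain j s where j: "l = fraction B S j s" "j \<in> J" "s \<in> S"
      using l unfolding extended_ideal_def by blast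
    obtain j' s' where j': "l' = fraction C S' j' s'" "j' \<in> J'" "s' \<in> S'"
      using l' unfolding extended_ideal_def by blast
    obtain u k where u: "u \<in> ?U" "k \<in> J" "s = f u \<oplus>\<^bsub>B\<^esub> k"
      using j(3) unfolding S mem_image_set_add_iff by blast
    obtain v k' where v: "v \<in> ?U" "k' \<in> J'" "s' = g v \<oplus>\<^bsub>C\<^esub> k'"
      using j'(3) unfolding S' mem_image_set_add_iff by blast
    \<comment> \<open>The image of \<open>\<xi>\<close> and the two ideal terms are lifted by three
      separate fractions, since the presentations of the denominators \<open>s\<close> and
      \<open>s'\<close> involve unrelated \<open>u\<close> and \<open>v\<close>. The two lifts of
      ideal terms have a zero numerator in the other component, so they do not disturb it.\<close>
    have num: "(f a, g a) \<in> carrier ?D" "(j, \<zero>\<^bsub>C\<^esub>) \<in> carrier ?D" "(\<zero>\<^bsub>B\<^esub>, j') \<in> carrier ?D"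
      using DI[OF a(2) zJ zJ'] DI[OF zA j(2) zJ']
        DI[OF zA zJ j'(2)] a(2) j(2) j'(2) J.a_Hcarr J'.a_Hcarr by auto
    have den: "(f t, g t) \<in> ?T" "(s, g u) \<in> ?T" "(f v, s') \<in> ?T"
      using TI[OF a(3) zJ zJ'] TI[OF u(1,2) zJ']
        TI[OF v(1) zJ v(2)] a(3) u v by auto
    let ?x = "fraction ?D ?T (f a, g a) (f t, g t)"
    let ?y = "fraction ?D ?T (j, \<zero>\<^bsub>C\<^esub>) (s, g u)"
    let ?z = "fraction ?D ?T (\<zero>\<^bsub>B\<^esub>, j') (f v, s')"
    have xyz: "?x \<in> carrier ?Q" "?y \<in> carrier ?Q" "?z \<in> carrier ?Q"
      using num den by (auto intro: T.fraction_closed)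
    have "?\<phi> ?x = (induced_map B S f \<xi>, induced_map C S' g \<xi>)"
      using induced_map_fraction[OF U.mult_subset_axioms imB(1) assms(4) imB(2) a(2,3)]
        induced_map_fraction[OF U.mult_subset_axioms imC(1) assms(5) imC(2) a(2,3)]
      unfolding a(1) ind[OF num(1) den(1)] by simp
    moreover have "?\<phi> ?y = (l, \<zero>\<^bsub>?CS\<^esub>)"
      unfolding ind[OF num(2) den(2)] using TS(2)[OF den(2)]
      by (simp add: j(1) CS.fraction_zero_numerator)
    moreover have "?\<phi> ?z = (\<zero>\<^bsub>?BS\<^esub>, l')"
      unfolding ind[OF num(3) den(3)] using TS(1)[OF den(3)]
      by (simp add: j'(1) BS.fraction_zero_numerator)
    moreover have "?\<phi> (?x \<oplus>\<^bsub>?Q\<^esub> (?y \<oplus>\<^bsub>?Q\<^esub> ?z)) = ?\<phi> ?x \<oplus>\<^bsub>?E\<^esub> (?\<phi> ?y \<oplus>\<^bsub>?E\<^esub> ?\<phi> ?z)"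
      by (simp only: \<phi>.hom_add xyz Q.a_closed)
    ultimately have "?\<phi> (?x \<oplus>\<^bsub>?Q\<^esub> (?y \<oplus>\<^bsub>?Q\<^esub> ?z)) = y"
      using l l' JS.a_Hcarr JS'.a_Hcarr by (simp add: y biamalg_simps)
    then show ?thesis
      using xyz by (intro bexI[of _ "?x \<oplus>\<^bsub>?Q\<^esub> (?y \<oplus>\<^bsub>?Q\<^esub> ?z)"]) auto
  qed
  have surj: "?\<phi> ` carrier ?Q = carrier ?E"
    using \<phi>_closed onto by (intro equalityI subsetI) (blast, metis (no_types, lifting) imageI)
  have "a_kernel ?Q ?E ?\<phi> = {\<zero>\<^bsub>?Q\<^esub>}"
    unfolding a_kernel_def' using ker \<phi>.hom_zero Q.zero_closed by fast
  with surj have "bij_betw ?\<phi> (carrier ?Q) (carrier ?E)"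
    unfolding bij_betw_def by (intro conjI \<phi>.trivial_ker_imp_inj)
  with \<phi>_hom have "?\<phi> \<in> ring_iso ?Q ?E"
    unfolding ring_iso_def by simp
  then show ?thesis
    unfolding is_ring_iso_def localization_def by blast
qed

theorem proposition5p7:
  fixes A :: "('a, 'm) ring_scheme" and B :: "('b, 'n) ring_scheme" and C :: "('c, 'k) ring_scheme"
    and f :: "'a \<Rightarrow> 'b" and g :: "'a \<Rightarrow> 'c"
    and J :: "'b set" and J' :: "'c set" and I_o p :: "'a set"
    and P :: "('b \<times> 'c) set" and S :: "'b set" and S' :: "'c set"
    and f_p :: "('a \<times> 'a) set \<Rightarrow> ('b \<times> 'b) set" and g_p :: "('a \<times> 'a) set \<Rightarrow> ('c \<times> 'c) set"
  assumes "cring A" and "cring B" and "cring C"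
    and "f \<in> ring_hom A B" and "g \<in> ring_hom A C"
    and "ideal J B" and "ideal J' C"
    and "I_o = {a \<in> carrier A. f a \<in> J}" and "I_o = {a \<in> carrier A. g a \<in> J'}"
    and "primeideal p A" and "I_o \<subseteq> p"
    and "P = biamalg_set B C f g p J J'"
    and "S = f ` (carrier A - p) <+>\<^bsub>B\<^esub> J"
    and "S' = g ` (carrier A - p) <+>\<^bsub>C\<^esub> J'"
    and "f_p = induced_map B S f" and "g_p = induced_map C S' g"
  shows "{x \<in> carrier (localization A p). f_p x \<in> extended_ideal B S J} =
        {x \<in> carrier (localization A p). g_p x \<in> extended_ideal C S' J'} \<and>
      {x \<in> carrier (localization A p). g_p x \<in> extended_ideal C S' J'} =
        extended_ideal A (carrier A - p) I_o \<and>
      localization (biamalg A B C f g J J') P \<simeq>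
        biamalg (localization A p) (fraction_ring B S) (fraction_ring C S') f_p g_p
          (extended_ideal B S J) (extended_ideal C S' J')"
proof (intro conjI)
  \<comment> \<open>One lemma computes both preimages: \<open>I_o\<close> is read as the preimage of
    \<open>J'\<close> here and as the preimage of \<open>J\<close> for \<open>f_p\<close>.\<close>
  show "{x \<in> carrier (localization A p). g_p x \<in> extended_ideal C S' J'} =
      extended_ideal A (carrier A - p) I_o"
    using assms by (simp add: induced_map_vimage_extended_ideal)
  then show "{x \<in> carrier (localization A p). f_p x \<in> extended_ideal B S J} =
      {x \<in> carrier (localization A p). g_p x \<in> extended_ideal C S' J'}"
    using induced_map_vimage_extended_ideal[OF assms(1,2,4,6,10,13)] assms(8,15) by simp
  show "localization (biamalg A B C f g J J') P \<simeq>
      biamalg (localization A p) (fraction_ring B S) (fraction_ring C S') f_p g_p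
        (extended_ideal B S J) (extended_ideal C S' J')"
    unfolding assms(15,16)
    using assms(11) unfolding assms(8) by (rule localization_biamalg_iso[OF assms(1-7,10) _ assms(12-14)])
qed

end
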